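(* Let $\Delta$ be a unit-interval simplicial complex on $[n]$ with $\dim(\Delta)=d-1>1$, let $\Gamma=\mathrm{Ind}(\Delta)$, let $B_1,\dots,B_m$ be the maximal cliques of $\Delta$, and let $\mathcal P_\Gamma$ be the set of the height one monomial prime ideals of $R_\Gamma$ containing $t$. For $i\in[n]$ let $P_i=(\mathbf{x}_Ft:F\in\Gamma,\ i\notin F)\subset R_\Gamma$, and for $j\in[m]$ let $L_j=(\mathbf{x}_Ft:F\in\Gamma,\ |F\cap B_j|<d-1)\subset R_\Gamma$. Then $$\{P_i:i=1,\dots,n\}\cup\{L_j:j=1,\dots,m\}\subseteq\mathcal P_\Gamma.$$
   Context: For a pure $(d-1)$-dimensional simplicial complex $\Delta$ on vertex set $[n]$: a clique is a subset $C\subseteq[n]$ all of whose $d$-subsets are facets of $\Delta$; $\mathrm{Ind}(\Delta)$ is the simplicial complex of all subsets of $[n]$ containing no facet of $\Delta$. $\Delta$ is a unit-interval simplicial complex if it is pure and for every facet $\{i_1<\cdots<i_d\}$ the interval $[i_1,i_d]=\{i_1,i_1+1,\dots,i_d\}$ is a clique of $\Delta$. "Maximal cliques of $\Delta$" means the inclusion-maximal cliques with at least $d$ elements; these are intervals. Let $K$ be a field, $S=K[x_1,\dots,x_n]$, $\mathbf{x}_F=\prod_{i\in F}x_i$ ($\mathbf{x}_\emptyset=1$), and $R_\Gamma=K[\mathbf{x}_Ft:F\in\Gamma]\subset S[t]$, which is a normal Cohen-Macaulay domain. A monomial ideal of $R_\Gamma$ is an ideal generated by monomials $x_1^{a_1}\cdots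 x_n^{a_n}t^k\in R_\Gamma$. *)

theory Defs
  imports
    "HOL-Algebra.Algebra"
    "HOL-Algebra.Algebraic_Closure_Type"
    "HOL-Library.Poly_Mapping"
    "HOL-Library.Extended_Nat"
begin

definition simplicial_complex :: "nat \<Rightarrow> nat set set \<Rightarrow> bool" where
  "simplicial_complex n \<Delta> \<longleftrightarrow>
     \<Delta> \<subseteq> Pow {1..n} \<and> {} \<in> \<Delta> \<and> (\<forall>F\<in>\<Delta>. \<forall>G. G \<subseteq> F \<longrightarrow> G \<in> \<Delta>)"

definition facets :: "nat set set \<Rightarrow> nat set set" where
  "facets \<Delta> = {F \<in> \<Delta>. \<forall>G\<in>\<Delta>. F \<subseteq> G \<longrightarrow> G = F}"

definition complex_dim :: "nat set set \<Rightarrow> int" where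
  "complex_dim \<Delta> = int (Max (card ` \<Delta>)) - 1"

definition pure_complex :: "nat set set \<Rightarrow> bool" where
  "pure_complex \<Delta> \<longleftrightarrow> (\<forall>F\<in>facets \<Delta>. int (card F) - 1 = complex_dim \<Delta>)"

text \<open>
  For a complex of dimension \<open>d - 1\<close>, the sets \<open>F\<close> below are the \<open>d\<close>-subsets of \<open>C\<close>;
  in particular every set with fewer than \<open>d\<close> elements is a clique.
\<close>
definition clique :: "nat \<Rightarrow> nat set set \<Rightarrow> nat set \<Rightarrow> bool" where
  "clique n \<Delta> C \<longleftrightarrow>
     C \<subseteq> {1..n} \<and> (\<forall>F. F \<subseteq> C \<and> int (card F) - 1 = complex_dim \<Delta> \<longrightarrow> F \<in> facets \<Delta>)"

definition unit_interval_complex :: "nat \<Rightarrow> nat set set \<Rightarrow> bool" where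
  "unit_interval_complex n \<Delta> \<longleftrightarrow>
     simplicial_complex n \<Delta> \<and> pure_complex \<Delta> \<and>
     (\<forall>F\<in>facets \<Delta>. clique n \<Delta> {Min F..Max F})"

definition maximal_cliques :: "nat \<Rightarrow> nat set set \<Rightarrow> nat set set" where
  "maximal_cliques n \<Delta> =
     {C. clique n \<Delta> C \<and> complex_dim \<Delta> \<le> int (card C) - 1 \<and>
         (\<forall>D. clique n \<Delta> D \<and> C \<subseteq> D \<longrightarrow> D = C)}"

definition independence_complex :: "nat \<Rightarrow> nat set set \<Rightarrow> nat set set" where
  "independence_complex n \<Delta> = {F. F \<subseteq> {1..n} \<and> \<not> (\<exists>G\<in>facets \<Delta>. G \<subseteq> F)}"

text \<open>
  Polynomials over \<open>'k\<close> in variables indexed by the natural numbers: finitely supported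
  maps from exponent vectors to coefficients.  The variables \<open>1, \<dots>, n\<close> are
  \<open>x\<^sub>1, \<dots>, x\<^sub>n\<close>, and the variable with index \<open>0\<close> is \<open>t\<close>.  The ring \<open>R\<^sub>\<Gamma>\<close> for a
  complex \<open>\<Gamma>\<close> on \<open>{1..n}\<close> involves no other variables, so the ambient ring can be taken
  to be this type instead of \<open>K[x\<^sub>1, \<dots>, x\<^sub>n, t]\<close>.
\<close>
type_synonym 'k mpoly = "(nat \<Rightarrow>\<^sub>0 nat) \<Rightarrow>\<^sub>0 'k"

definition const_poly :: "'k::field \<Rightarrow> 'k mpoly" where
  "const_poly c = Poly_Mapping.single 0 c"

definition xvar :: "nat \<Rightarrow> 'k::field mpoly" where
  "xvar i = Poly_Mapping.single (Poly_Mapping.single i 1) 1"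

definition tvar :: "'k::field mpoly" where
  "tvar = Poly_Mapping.single (Poly_Mapping.single 0 1) 1"

definition xmon :: "nat set \<Rightarrow> 'k::field mpoly" where
  "xmon F = (\<Prod>i\<in>F. xvar i)"

text \<open>\<open>R\<^sub>\<Gamma>\<close> is the \<open>K\<close>-subalgebra generated by the \<open>x\<^sub>F t\<close>, that is, the subring
  generated by these elements and the constants.\<close>
definition toric_ring :: "nat set set \<Rightarrow> ('k::field mpoly) ring" where
  "toric_ring \<Gamma> = ring_of_type_algebra
     \<lparr>carrier := generate_ring ring_of_type_algebra
        (range const_poly \<union> {xmon F * tvar | F. F \<in> \<Gamma>})\<rparr>"

definition monomials :: "nat \<Rightarrow> ('k::field mpoly) set" where
  "monomials n = {(\<Prod>i\<in>{1..n}. xvar i ^ a i) * tvar ^ k | (a :: nat \<Rightarrow> nat) k. True}"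

definition monomial_ideal :: "nat \<Rightarrow> nat set set \<Rightarrow> ('k::field mpoly) set \<Rightarrow> bool" where
  "monomial_ideal n \<Gamma> I \<longleftrightarrow>
     (\<exists>M \<subseteq> monomials n \<inter> carrier (toric_ring \<Gamma>). I = Idl\<^bsub>toric_ring \<Gamma>\<^esub> M)"

definition height :: "('a, 'b) ring_scheme \<Rightarrow> 'a set \<Rightarrow> enat" where
  "height R P = Sup {enat k | k. \<exists>Q :: nat \<Rightarrow> 'a set.
     (\<forall>i\<le>k. primeideal (Q i) R) \<and> (\<forall>i<k. Q i \<subset> Q (Suc i)) \<and> Q k = P}"

definition height_one_monomial_primes_t :: "nat \<Rightarrow> nat set set \<Rightarrow> ('k::field mpoly) set set" where
  "height_one_monomial_primes_t n \<Gamma> =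
     {P. primeideal P (toric_ring \<Gamma>) \<and> height (toric_ring \<Gamma>) P = 1 \<and>
         monomial_ideal n \<Gamma> P \<and> tvar \<in> P}"

definition P_ideal :: "nat set set \<Rightarrow> nat \<Rightarrow> ('k::field mpoly) set" where
  "P_ideal \<Gamma> i = Idl\<^bsub>toric_ring \<Gamma>\<^esub> {xmon F * tvar | F. F \<in> \<Gamma> \<and> i \<notin> F}"

definition L_ideal :: "nat set set \<Rightarrow> nat \<Rightarrow> nat set \<Rightarrow> ('k::field mpoly) set" where
  "L_ideal \<Gamma> d B =
     Idl\<^bsub>toric_ring \<Gamma>\<^esub> {xmon F * tvar | F. F \<in> \<Gamma> \<and> int (card (F \<inter> B)) < int d - 1}"

end

theory Submission
  imports Defs
begin

text \<open>
  \<open>R\<^sub>\<Gamma>\<close> is a monoid algebra, and each ideal in question is spanned by the monomials of positive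
  value under an additive weight \<open>w\<close> that is nonnegative on \<open>R\<^sub>\<Gamma>\<close>; comparing the parts of weight zero
  shows that such an ideal \<open>P\<close> is prime. After inverting the monomials of weight zero, \<open>P\<close> is
  generated by a single monomial \<open>y\<close> of weight one, so a nonzero prime \<open>Q \<subseteq> P\<close> contains \<open>y\<close> and
  hence equals \<open>P\<close>. The combinatorial input is that there are enough faces of weight zero for
  any two monomials of equal weight to become associated in this localization.
\<close>

section \<open>Monoid algebras graded by a weight\<close>

text \<open>An element supported in \<open>S\<close> is the finite sum of its terms, so additive
  claims about spans of monomials reduce to a single term.\<close>

lemma poly_mapping_span_induct [consumes 1, case_names zero single add]:
  fixes f :: "'a \<Rightarrow>\<^sub>0 'b::comm_monoid_add"
  assumes "Poly_Mapping.keys f \<subseteq> S"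
    and zero: "P 0"
    and single: "\<And>a c. a \<in> S \<Longrightarrow> P (Poly_Mapping.single a c)"
    and add: "\<And>f g. P f \<Longrightarrow> P g \<Longrightarrow> P (f + g)"
  shows "P f"
proof -
  have "P (\<Sum>a\<in>T. Poly_Mapping.single a (Poly_Mapping.lookup f a))"
    if "finite T" "T \<subseteq> S" for T
    using that by (induction T) (auto intro: zero single add)
  moreover have "f = (\<Sum>a\<in>Poly_Mapping.keys f. Poly_Mapping.single a (Poly_Mapping.lookup f a))"
    by (intro poly_mapping_eqI)
      (auto simp: lookup_sum lookup_single when_def in_keys_iff)
  ultimately show ?thesis
    using assms(1) by (metis finite_keys)
qed

lemma lookup_single_times:
  fixes f :: "'a::{cancel_ab_semigroup_add,comm_monoid_add} \<Rightarrow>\<^sub>0 'b::comm_semiring_1"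
  shows "Poly_Mapping.lookup (Poly_Mapping.single m 1 * f) (m + e) = Poly_Mapping.lookup f e"
proof -
  have "Poly_Mapping.keys f \<subseteq> UNIV" by simp
  then show ?thesis
    by (induction rule: poly_mapping_span_induct)
      (auto simp: mult_single lookup_single when_def distrib_left lookup_add)
qed

lemma Sup_enat_eq_one:
  assumes "\<And>k. P k \<Longrightarrow> k \<le> 1" "P 1"
  shows "Sup {enat k |k. P k} = 1"
  using assms by (intro antisym Sup_least Sup_upper) (auto simp: one_enat_def)

text \<open>The order on the exponents supplies the instance by which the full algebra has no zero
  divisors; the subalgebra spanned by \<open>M\<close> inherits this.\<close>

definition monoid_algebra ::
    "'a::{ordered_cancel_comm_monoid_add,linorder} set \<Rightarrow> ('a \<Rightarrow>\<^sub>0 'k::field) ring" where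
  "monoid_algebra M = ring_of_type_algebra \<lparr>carrier := {f. Poly_Mapping.keys f \<subseteq> M}\<rparr>"

lemma monoid_algebra_simps [simp]:
  "carrier (monoid_algebra M) = {f. Poly_Mapping.keys f \<subseteq> M}"
  "f \<oplus>\<^bsub>monoid_algebra M\<^esub> g = f + g"
  "f \<otimes>\<^bsub>monoid_algebra M\<^esub> g = f * g"
  "\<zero>\<^bsub>monoid_algebra M\<^esub> = 0"
  "\<one>\<^bsub>monoid_algebra M\<^esub> = 1"
  by (simp_all add: monoid_algebra_def ring_of_type_algebra_def)

text \<open>The weight is additive on all exponents but nonnegative only on \<open>M\<close>. The
  condition \<open>y_divides\<close> makes \<open>y\<close> a divisor of every monomial of positive
  weight in the localization at the monomials of weight zero.\<close>

locale weighted_monoid =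
  fixes M :: "'a::{ordered_cancel_comm_monoid_add,linorder} set"
    and w :: "'a \<Rightarrow> int" and y :: 'a
  assumes zero_in: "0 \<in> M"
    and add_in: "a \<in> M \<Longrightarrow> b \<in> M \<Longrightarrow> a + b \<in> M"
    and w_add: "w (a + b) = w a + w b"
    and w_nonneg: "a \<in> M \<Longrightarrow> 0 \<le> w a"
    and y_in: "y \<in> M" and w_y: "w y = 1"
    and y_divides: "u \<in> M \<Longrightarrow> 0 < w u \<Longrightarrow>
      \<exists>m\<in>M. \<exists>u'\<in>M. w m = 0 \<and> m + u = y + u'"
begin

lemma w_zero: "w 0 = 0"
  using w_add[of 0 0] by simp

lemma keys_mult_in:
  assumes "Poly_Mapping.keys f \<subseteq> M" "Poly_Mapping.keys g \<subseteq> M"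
  shows "Poly_Mapping.keys (f * g :: 'a \<Rightarrow>\<^sub>0 'k::field) \<subseteq> M"
  using keys_mult[of f g] assms add_in by blast

lemma keys_add_in:
  assumes "Poly_Mapping.keys f \<subseteq> S" "Poly_Mapping.keys g \<subseteq> S"
  shows "Poly_Mapping.keys (f + g :: 'a \<Rightarrow>\<^sub>0 'k::field) \<subseteq> S"
  using keys_add[of f g] assms by blast

lemma keys_uminus: "Poly_Mapping.keys (- f :: 'a \<Rightarrow>\<^sub>0 'k::field) = Poly_Mapping.keys f"
  by (auto simp: in_keys_iff)

lemma domain_monoid_algebra: "domain (monoid_algebra M :: ('a \<Rightarrow>\<^sub>0 'k::field) ring)"
proof -
  let ?R = "monoid_algebra M :: ('a \<Rightarrow>\<^sub>0 'k::field) ring"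
  have "cring ?R"
  proof (rule cringI)
    show "abelian_group ?R"
    proof (rule abelian_groupI)
      show "\<exists>g\<in>carrier ?R. g \<oplus>\<^bsub>?R\<^esub> f = \<zero>\<^bsub>?R\<^esub>" if "f \<in> carrier ?R" for f
        using that by (intro bexI[of _ "- f"]) (auto simp: keys_uminus)
    qed (auto simp: algebra_simps dest: keys_add_in[THEN subsetD, rotated 2])
    show "Group.comm_monoid ?R"
      by unfold_locales
        (auto simp: algebra_simps zero_in dest: keys_mult_in[THEN subsetD, rotated 2])
  qed (auto simp: algebra_simps)
  then show ?thesis
    by (auto simp: domain_def domain_axioms_def)
qed

text \<open>The weight zero exponents form a face of the monoid \<open>M\<close>; this is the span
  of the monomials off that face.\<close>

definition positive_part :: "('a \<Rightarrow>\<^sub>0 'k::field) set" where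
  "positive_part = {f. Poly_Mapping.keys f \<subseteq> {a \<in> M. 0 < w a}}"

lemma positive_part_mult:
  assumes "f \<in> positive_part" "Poly_Mapping.keys g \<subseteq> M"
  shows "f * g \<in> positive_part"
proof -
  have "a + b \<in> M \<and> 0 < w (a + b)" if "a \<in> M" "0 < w a" "b \<in> M" for a b
    using that w_nonneg[of b] by (simp add: w_add add_in)
  then show ?thesis
    using keys_mult[of f g] assms unfolding positive_part_def by blast
qed

lemma positive_part_add:
  "f \<in> positive_part \<Longrightarrow> g \<in> positive_part \<Longrightarrow> f + g \<in> positive_part"
  using keys_add_in unfolding positive_part_def by blast

lemma positive_part_uminus: "f \<in> positive_part \<Longrightarrow> - f \<in> positive_part"
  by (simp add: positive_part_def keys_uminus)

lemma zero_in_positive_part: "0 \<in> positive_part"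
  by (simp add: positive_part_def)

lemma weight_decomposition:
  fixes f :: "'a \<Rightarrow>\<^sub>0 'k::field"
  assumes "Poly_Mapping.keys f \<subseteq> M"
  obtains f0 f1 where "f = f0 + f1" "Poly_Mapping.keys f0 \<subseteq> {a \<in> M. w a = 0}"
    "f1 \<in> positive_part"
proof -
  let ?D = "\<lambda>f. \<exists>f0 f1. f = f0 + f1 \<and> Poly_Mapping.keys f0 \<subseteq> {a \<in> M. w a = 0} \<and>
    f1 \<in> positive_part"
  from assms have "?D f"
  proof (induction rule: poly_mapping_span_induct)
    case zero
    show ?case using zero_in_positive_part by (intro exI[of _ 0]) auto
  next
    case (single a c)
    show ?case
    proof (cases "w a = 0")
      case True
      with single zero_in_positive_part show ?thesis
        by (intro exI[of _ "Poly_Mapping.single a c"] exI[of _ 0]) auto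
    next
      case False
      with single w_nonneg[of a] show ?thesis
        by (intro exI[of _ 0] exI[of _ "Poly_Mapping.single a c"])
          (auto simp: positive_part_def)
    qed
  next
    case (add f g)
    then obtain f0 f1 g0 g1 where
      "f = f0 + f1" "Poly_Mapping.keys f0 \<subseteq> {a \<in> M. w a = 0}" "f1 \<in> positive_part"
      "g = g0 + g1" "Poly_Mapping.keys g0 \<subseteq> {a \<in> M. w a = 0}" "g1 \<in> positive_part"
      by blast
    then show ?case
      using keys_add_in[of f0 _ g0] positive_part_add[of f1 g1]
      by (intro exI[of _ "f0 + g0"] exI[of _ "f1 + g1"]) (auto simp: algebra_simps)
  qed
  with that show thesis by blast
qed

lemma ideal_positive_part: "ideal positive_part (monoid_algebra M :: ('a \<Rightarrow>\<^sub>0 'k::field) ring)"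
proof -
  let ?R = "monoid_algebra M :: ('a \<Rightarrow>\<^sub>0 'k::field) ring"
  interpret R: domain ?R by (rule domain_monoid_algebra)
  show ?thesis
  proof (rule idealI)
    show "subgroup positive_part (add_monoid ?R)"
    proof (rule R.add.subgroupI)
      show "\<ominus>\<^bsub>?R\<^esub> a \<in> positive_part" if "a \<in> positive_part" for a
      proof -
        have "\<ominus>\<^bsub>?R\<^esub> a = - a"
          by (rule R.minus_equality)
            (use that in \<open>auto simp: positive_part_def keys_uminus\<close>)
        then show ?thesis using that positive_part_uminus by simp
      qed
    next
      show "positive_part \<subseteq> carrier ?R"
        by (auto simp: positive_part_def)
    next
      show "positive_part \<noteq> {}"
        using zero_in_positive_part by blast
    qed (simp add: positive_part_add)
  qed (auto simp: R.ring_axioms intro: positive_part_mult, metis mult.commute positive_part_mult)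
qed

text \<open>Modulo \<open>positive_part\<close> only the weight zero parts survive, and they
  multiply inside a domain.\<close>

lemma primeideal_positive_part:
  "primeideal positive_part (monoid_algebra M :: ('a \<Rightarrow>\<^sub>0 'k::field) ring)"
proof -
  let ?R = "monoid_algebra M :: ('a \<Rightarrow>\<^sub>0 'k::field) ring"
  interpret R: domain ?R by (rule domain_monoid_algebra)
  show ?thesis
  proof (rule primeidealI)
    have "1 \<notin> (positive_part :: ('a \<Rightarrow>\<^sub>0 'k) set)"
      by (simp add: positive_part_def w_zero)
    with R.one_closed show "carrier ?R \<noteq> positive_part"
      by auto
  next
    fix f g assume "f \<in> carrier ?R" "g \<in> carrier ?R" and fg: "f \<otimes>\<^bsub>?R\<^esub> g \<in> positive_part"
    then have f: "Poly_Mapping.keys f \<subseteq> M" and g: "Poly_Mapping.keys g \<subseteq> M" by auto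
    obtain f0 f1 where f01: "f = f0 + f1" "Poly_Mapping.keys f0 \<subseteq> {a \<in> M. w a = 0}"
      "f1 \<in> positive_part" using weight_decomposition[OF f] .
    obtain g0 g1 where g01: "g = g0 + g1" "Poly_Mapping.keys g0 \<subseteq> {a \<in> M. w a = 0}"
      "g1 \<in> positive_part" using weight_decomposition[OF g] .
    have "f0 * g0 = f * g + - (f1 * g + g1 * f0)"
      by (simp add: f01 g01 algebra_simps)
    also have "\<dots> \<in> positive_part"
    proof (intro positive_part_add positive_part_uminus)
      show "f * g \<in> positive_part" using fg by simp
      show "f1 * g \<in> positive_part" using f01(3) g by (rule positive_part_mult)
      show "g1 * f0 \<in> positive_part" using g01(3) f01(2) by (intro positive_part_mult) auto
    qed
    finally have pos: "f0 * g0 \<in> positive_part" .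
    \<comment> \<open>The product has only terms of weight zero, while membership in
      \<open>positive_part\<close> allows only terms of positive weight; hence it vanishes.\<close>
    have "Poly_Mapping.keys (f0 * g0) \<subseteq> {a. w a = 0}"
      using keys_mult[of f0 g0] f01(2) g01(2) by (force simp: w_add)
    with pos have "Poly_Mapping.keys (f0 * g0) = {}"
      by (fastforce simp: positive_part_def)
    then have "f0 * g0 = 0"
      by (simp add: poly_mapping_eq_iff fun_eq_iff in_keys_iff set_eq_iff)
    then have "f0 = 0 \<or> g0 = 0" by simp
    with f01(1,3) g01(1,3) show "f \<in> positive_part \<or> g \<in> positive_part"
      by (metis add_0)
  qed (auto simp: ideal_positive_part R.is_cring)
qed

text \<open>Each term has its own weight zero multiplier; as with common denominators, the product
  of these multipliers works for all terms at once.\<close>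

lemma y_divides_positive_part:
  fixes f :: "'a \<Rightarrow>\<^sub>0 'k::field"
  assumes "f \<in> positive_part"
  shows "\<exists>m\<in>M. \<exists>g. w m = 0 \<and> Poly_Mapping.keys g \<subseteq> M \<and>
    Poly_Mapping.single m 1 * f = Poly_Mapping.single y 1 * g"
proof -
  from assms have "Poly_Mapping.keys f \<subseteq> {a \<in> M. 0 < w a}"
    by (simp add: positive_part_def)
  then show ?thesis
  proof (induction rule: poly_mapping_span_induct)
    case zero
    show ?case using zero_in w_zero by (intro bexI[of _ 0] exI[of _ 0]) auto
  next
    case (single a c)
    then obtain m u where "m \<in> M" "u \<in> M" "w m = 0" "m + a = y + u"
      using y_divides by blast
    then show ?case
      by (intro bexI[of _ m] exI[of _ "Poly_Mapping.single u c"]) (auto simp: mult_single)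
  next
    case (add f1 f2)
    then obtain m1 g1 m2 g2 where
      1: "m1 \<in> M" "w m1 = 0" "Poly_Mapping.keys g1 \<subseteq> M"
        "Poly_Mapping.single m1 1 * f1 = Poly_Mapping.single y 1 * g1" and
      2: "m2 \<in> M" "w m2 = 0" "Poly_Mapping.keys g2 \<subseteq> M"
        "Poly_Mapping.single m2 1 * f2 = Poly_Mapping.single y 1 * g2"
      by blast
    let ?g = "Poly_Mapping.single m2 1 * g1 + Poly_Mapping.single m1 1 * g2"
    have "Poly_Mapping.single (m1 + m2) 1 * (f1 + f2) =
        Poly_Mapping.single m2 1 * (Poly_Mapping.single m1 1 * f1) +
        Poly_Mapping.single m1 1 * (Poly_Mapping.single m2 (1::'k) * f2)"
      by (simp add: distrib_left mult_single add.commute flip: mult.assoc)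
    also have "\<dots> = Poly_Mapping.single y 1 * ?g"
      unfolding 1 2 by (simp only: distrib_left mult.left_commute)
    finally have "Poly_Mapping.single (m1 + m2) 1 * (f1 + f2) = Poly_Mapping.single y 1 * ?g" .
    moreover have "Poly_Mapping.keys ?g \<subseteq> M"
      using 1 2 by (intro keys_add_in keys_mult_in) auto
    ultimately show ?case
      using 1 2 add_in[of m1 m2] w_add[of m1 m2] by (intro bexI[of _ "m1 + m2"] exI[of _ ?g]) auto
  qed
qed

text \<open>A nonzero element of \<open>Q\<close> can be divided by \<open>y\<close>, up to a monomial of weight zero (which is
  not in \<open>Q\<close>), and this lowers the weights of its terms; so \<open>Q\<close> must contain \<open>y\<close>.\<close>

lemma primeideal_below_positive_part:
  fixes Q :: "('a \<Rightarrow>\<^sub>0 'k::field) set"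
  assumes "primeideal Q (monoid_algebra M)" and sub: "Q \<subseteq> positive_part" and "\<not> Q \<subseteq> {0}"
  shows "Q = positive_part"
proof -
  interpret Q: primeideal Q "monoid_algebra M :: ('a \<Rightarrow>\<^sub>0 'k) ring" by fact
  have weight0: "Poly_Mapping.single m (1::'k) \<notin> Q" if "w m = 0" for m
    using that sub by (auto simp: positive_part_def)
  have prime: "f \<in> Q \<or> g \<in> Q"
    if "f * g \<in> Q" "Poly_Mapping.keys f \<subseteq> M" "Poly_Mapping.keys g \<subseteq> M" for f g
    using Q.I_prime[of f g] that by simp
  have mult: "f * g \<in> Q" "g * f \<in> Q" if "f \<in> Q" "Poly_Mapping.keys g \<subseteq> M" for f g
    using Q.I_l_closed[of f g] Q.I_r_closed[of f g] that by auto
  \<comment> \<open>The induction follows one term \<open>e\<close> of \<open>f\<close>, so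
    \<open>f\<close> may be inhomogeneous: division by \<open>y\<close> turns \<open>e\<close> into
    a term of \<open>g\<close> whose weight is smaller by one. Since weights of terms in
    \<open>Q\<close> stay positive, the descent stops, and it can only stop with \<open>y\<close> in
    \<open>Q\<close>.\<close>
  have "Poly_Mapping.single y (1::'k) \<in> Q"
    if "f \<in> Q" "e \<in> Poly_Mapping.keys f" for f e
    using that
  proof (induction "nat (w e)" arbitrary: f e rule: less_induct)
    case less
    with sub have f: "f \<in> positive_part" by blast
    then obtain m g where m: "m \<in> M" "w m = 0" and g: "Poly_Mapping.keys g \<subseteq> M"
      and eq: "Poly_Mapping.single m 1 * f = Poly_Mapping.single y 1 * g"
      using y_divides_positive_part by blast
    have "Poly_Mapping.single y 1 * g \<in> Q"
      using mult(2)[OF less.prems(1)] m by (simp flip: eq)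
    then consider "Poly_Mapping.single y (1::'k) \<in> Q" | "g \<in> Q"
      using prime[of "Poly_Mapping.single y 1" g] g y_in by auto
    then show ?case
    proof cases
      case 2
      \<comment> \<open>Multiplication by a monomial shifts exponents injectively, so the followed
        term cannot cancel.\<close>
      have "m + e \<in> Poly_Mapping.keys (Poly_Mapping.single m 1 * f)"
        using less.prems(2) by (simp add: in_keys_iff lookup_single_times)
      then obtain e' where e': "e' \<in> Poly_Mapping.keys g" "m + e = y + e'"
        using keys_mult[of "Poly_Mapping.single y 1" g] by (auto simp: eq)
      from arg_cong[OF e'(2), of w] have "w e' = w e - 1"
        by (simp add: w_add m w_y)
      moreover have "0 < w e"
        using f less.prems(2) by (auto simp: positive_part_def)
      ultimately show ?thesis
        using less.hyps[OF _ 2 e'(1)] by simp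
    qed
  qed
  moreover obtain f where "f \<in> Q" "f \<noteq> 0"
    using assms(3) by auto
  moreover from \<open>f \<noteq> 0\<close> obtain e where "e \<in> Poly_Mapping.keys f"
    by (auto simp: poly_mapping_eq_iff fun_eq_iff in_keys_iff)
  ultimately have y: "Poly_Mapping.single y (1::'k) \<in> Q" by blast
  \<comment> \<open>Conversely, a term of positive weight times some \<open>m\<close> of weight zero
    is a multiple of \<open>y\<close>, hence in \<open>Q\<close>; primality removes
    \<open>m\<close>, which is not in \<open>Q\<close>.\<close>
  have "f \<in> Q" if "f \<in> positive_part" for f
  proof -
    from that have "Poly_Mapping.keys f \<subseteq> {a \<in> M. 0 < w a}"
      by (simp add: positive_part_def)
    then show ?thesis
    proof (induction rule: poly_mapping_span_induct)
      case zero
      show ?case using additive_subgroup.zero_closed[OF Q.is_additive_subgroup] by simp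
    next
      case (single a c)
      then obtain m u where m: "m \<in> M" "u \<in> M" "w m = 0" "m + a = y + u"
        using y_divides by blast
      have "Poly_Mapping.single m 1 * Poly_Mapping.single a c =
          Poly_Mapping.single y 1 * Poly_Mapping.single u c"
        by (simp add: mult_single m)
      also have "\<dots> \<in> Q" using y m by (intro mult) auto
      finally show ?case
        using prime[of "Poly_Mapping.single m 1" "Poly_Mapping.single a c"] weight0 m single
        by auto
    next
      case (add f g)
      then show ?case using additive_subgroup.a_closed[OF Q.is_additive_subgroup] by simp
    qed
  qed
  with sub show ?thesis by blast
qed

lemma height_positive_part:
  "height (monoid_algebra M :: ('a \<Rightarrow>\<^sub>0 'k::field) ring) positive_part = 1"
proof -
  let ?R = "monoid_algebra M :: ('a \<Rightarrow>\<^sub>0 'k::field) ring"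
  let ?C = "\<lambda>k Q. (\<forall>i\<le>k. primeideal (Q i) ?R) \<and> (\<forall>i<k. Q i \<subset> Q (Suc i)) \<and>
    Q k = positive_part"
  interpret R: domain ?R by (rule domain_monoid_algebra)
  have len: "k \<le> 1" if Q: "?C k Q" for k and Q :: "nat \<Rightarrow> ('a \<Rightarrow>\<^sub>0 'k) set"
  proof (rule ccontr)
    assume "\<not> k \<le> 1"
    then obtain l where k: "k = Suc (Suc l)"
      by (metis One_nat_def bot_nat_0.extremum not0_implies_Suc not_less_eq_eq)
    \<comment> \<open>In a chain of length at least two, the last prime before
      \<open>positive_part\<close> strictly contains another ideal, so it is nonzero, and yet it is
      strictly below \<open>positive_part\<close>.\<close>
    have "0 \<in> Q l"
      using Q k additive_subgroup.zero_closed[of "Q l" ?R]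
      by (auto simp: primeideal_def ideal_def)
    moreover have "Q l \<subset> Q (Suc l)" "Q (Suc l) \<subset> positive_part" "primeideal (Q (Suc l)) ?R"
      using Q k by auto
    ultimately show False
      using primeideal_below_positive_part[of "Q (Suc l)"] by blast
  qed
  \<comment> \<open>The zero ideal is prime in a domain, and the monomial \<open>y\<close> makes the
    inclusion strict.\<close>
  have "?C 1 (\<lambda>i. if i = 0 then {0} else positive_part)"
  proof -
    have "Poly_Mapping.single y 1 \<in> (positive_part :: ('a \<Rightarrow>\<^sub>0 'k) set)"
      by (simp add: positive_part_def y_in w_y)
    moreover have "Poly_Mapping.single y (1::'k) \<noteq> 0"
      by (simp add: poly_mapping_eq_iff fun_eq_iff lookup_single when_def)
    ultimately have "{0} \<subset> (positive_part :: ('a \<Rightarrow>\<^sub>0 'k) set)"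
      using zero_in_positive_part by blast
    then show ?thesis
      using R.zeroprimeideal primeideal_positive_part by auto
  qed
  then have "\<exists>Q. ?C 1 Q" by (rule exI[of "?C 1" "\<lambda>i. if i = 0 then {0} else positive_part"])
  then show ?thesis
    unfolding height_def by (intro Sup_enat_eq_one) (elim exE, rule len)
qed

end

section \<open>The toric ring as a monoid algebra\<close>

definition generator_exponent :: "nat set \<Rightarrow> nat \<Rightarrow>\<^sub>0 nat" where
  "generator_exponent F = (\<Sum>i\<in>F. Poly_Mapping.single i 1) + Poly_Mapping.single 0 1"

lemma xmon_times_tvar:
  "xmon F * tvar = (Poly_Mapping.single (generator_exponent F) 1 :: 'k::field mpoly)"
proof -
  \<comment> \<open>For infinite \<open>F\<close> the product defaults to 1 and the sum to 0, so
    both sides still agree.\<close>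
  have "xmon F = (Poly_Mapping.single (\<Sum>i\<in>F. Poly_Mapping.single i 1) 1 :: 'k mpoly)"
    by (induction F rule: infinite_finite_induct)
      (auto simp: xmon_def xvar_def mult_single)
  then show ?thesis
    by (simp add: tvar_def mult_single generator_exponent_def)
qed

lemma lookup_generator_exponent:
  assumes "F \<subseteq> {1..n}"
  shows "Poly_Mapping.lookup (generator_exponent F) i = (if i = 0 \<or> i \<in> F then 1 else 0)"
proof -
  have "finite F" "0 \<notin> F"
    using assms finite_subset by fastforce+
  then show ?thesis
    by (auto simp: generator_exponent_def lookup_add lookup_sum lookup_single when_def)
qed

text \<open>The submonoid generated by the exponents of the \<open>x\<^sub>F t\<close>, presented so
  that induction peels off one generator at a time.\<close>

inductive_set toric_exponents :: "nat set set \<Rightarrow> (nat \<Rightarrow>\<^sub>0 nat) set"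
  for \<Gamma> :: "nat set set" where
  zero: "0 \<in> toric_exponents \<Gamma>"
| step: "F \<in> \<Gamma> \<Longrightarrow> e \<in> toric_exponents \<Gamma> \<Longrightarrow> generator_exponent F + e \<in> toric_exponents \<Gamma>"

lemma generator_in_toric_exponents: "F \<in> \<Gamma> \<Longrightarrow> generator_exponent F \<in> toric_exponents \<Gamma>"
  using toric_exponents.step[OF _ toric_exponents.zero] by simp

lemma toric_exponents_add:
  "a \<in> toric_exponents \<Gamma> \<Longrightarrow> b \<in> toric_exponents \<Gamma> \<Longrightarrow> a + b \<in> toric_exponents \<Gamma>"
  by (induction rule: toric_exponents.induct) (auto simp: add.assoc intro: toric_exponents.step)

text \<open>Elements supported on the exponent monoid form a subring containing the generators;
  conversely each of their terms is a constant times a product of generators.\<close>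

lemma toric_ring_eq_monoid_algebra:
  "(toric_ring \<Gamma> :: ('k::field mpoly) ring) = monoid_algebra (toric_exponents \<Gamma>)"
proof -
  let ?T = "ring_of_type_algebra :: ('k mpoly) ring"
  let ?H = "range const_poly \<union> {xmon F * tvar | F. F \<in> \<Gamma>} :: 'k mpoly set"
  interpret T: ring ?T by (rule ring_from_type_algebra)
  have simps [simp]: "carrier ?T = UNIV" "f \<oplus>\<^bsub>?T\<^esub> g = f + g" "f \<otimes>\<^bsub>?T\<^esub> g = f * g"
    "\<zero>\<^bsub>?T\<^esub> = 0" "\<one>\<^bsub>?T\<^esub> = 1" for f g
    by (simp_all add: ring_of_type_algebra_def)
  have uminus: "\<ominus>\<^bsub>?T\<^esub> f = - f" for f
    by (rule T.minus_equality) auto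
  have "generate_ring ?T ?H = {f. Poly_Mapping.keys f \<subseteq> toric_exponents \<Gamma>}"
  proof (intro equalityI subsetI CollectI)
    fix f assume "f \<in> generate_ring ?T ?H"
    then have "Poly_Mapping.keys f \<subseteq> toric_exponents \<Gamma>"
    proof induction
      case one
      show ?case using toric_exponents.zero by simp
    next
      case (incl f)
      then show ?case
        using toric_exponents.zero generator_in_toric_exponents
        by (auto simp: const_poly_def xmon_times_tvar split: if_splits)
    next
      case (a_inv f)
      then show ?case by (auto simp: uminus in_keys_iff)
    next
      case (eng_add f g)
      then show ?case using keys_add[of f g] by auto
    next
      case (eng_mult f g)
      then show ?case using keys_mult[of f g] toric_exponents_add by fastforce
    qed
    then show "e \<in> toric_exponents \<Gamma>" if "e \<in> Poly_Mapping.keys f" for e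
      using that by blast
  next
    fix f :: "'k mpoly" assume "f \<in> {f. Poly_Mapping.keys f \<subseteq> toric_exponents \<Gamma>}"
    then have "Poly_Mapping.keys f \<subseteq> toric_exponents \<Gamma>" by simp
    then show "f \<in> generate_ring ?T ?H"
    proof (induction rule: poly_mapping_span_induct)
      case zero
      show ?case using T.zero_in_generate by simp
    next
      case (single a c)
      then show ?case
      proof (induction rule: toric_exponents.induct)
        case zero
        \<comment> \<open>The coefficient enters at the base case, so the later factors are
          generators with coefficient 1.\<close>
        have "const_poly c \<in> generate_ring ?T ?H" by (rule generate_ring.incl) simp
        then show ?case by (simp add: const_poly_def)
      next
        case (step F e)
        then have "xmon F * tvar \<in> generate_ring ?T ?H"
          by (intro generate_ring.incl) auto
        from generate_ring.eng_mult[OF this step.IH] show ?case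
          by (simp add: xmon_times_tvar mult_single)
      qed
    next
      case (add f g)
      then show ?case using generate_ring.eng_add[of f ?T ?H g] by simp
    qed
  qed
  then show ?thesis
    by (simp add: toric_ring_def monoid_algebra_def)
qed

lemma xmon_times_tvar_in_monomials:
  assumes "F \<subseteq> {1..n}"
  shows "(xmon F * tvar :: 'k::field mpoly) \<in> monomials n"
proof -
  have "(\<Prod>i\<in>{1..n}. xvar i ^ (if i \<in> F then 1 else 0) :: 'k mpoly) =
      (\<Prod>i\<in>{1..n}. if i \<in> F then xvar i else 1)"
    by (rule prod.cong) auto
  also have "\<dots> = xmon F"
    using assms by (simp add: xmon_def prod.If_cases Int_absorb1)
  finally show ?thesis
    unfolding monomials_def
    by (intro CollectI exI[of _ "\<lambda>i. if i \<in> F then 1 else 0"] exI[of _ 1]) simp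
qed

section \<open>Height one primes from vertex sets\<close>

text \<open>Both families of ideals arise from the weight \<open>p k - \<Sum>\<^bsub>i \<in> B\<^esub> a\<^sub>i\<close> of the monomial \<open>x\<^sup>a t\<^sup>k\<close>:
  \<open>P\<^sub>i\<close> from \<open>B = {i}\<close> and \<open>p = 1\<close>, and \<open>L\<^sub>j\<close> from \<open>B = B\<^sub>j\<close> and \<open>p = d - 1\<close>.\<close>

locale facet_weight =
  fixes n p :: nat and \<Gamma> :: "nat set set" and B :: "nat set"
  assumes face_subset: "F \<in> \<Gamma> \<Longrightarrow> F \<subseteq> {1..n}"
    and B_subset: "B \<subseteq> {1..n}"
    and card_face_Int: "F \<in> \<Gamma> \<Longrightarrow> card (F \<inter> B) \<le> p"
    and small_face: "A \<subseteq> B \<Longrightarrow> card A \<le> p \<Longrightarrow> A \<in> \<Gamma>"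
    and p_pos: "1 \<le> p" and p_le: "p \<le> card B" and p_less: "p < card B \<or> card B = 1"
    and extend_face: "i \<in> {1..n} \<Longrightarrow> i \<notin> B \<Longrightarrow> \<exists>A\<subseteq>B. card A = p \<and> insert i A \<in> \<Gamma>"
begin

definition weight :: "(nat \<Rightarrow>\<^sub>0 nat) \<Rightarrow> int" where
  "weight e = int p * int (Poly_Mapping.lookup e 0) - (\<Sum>i\<in>B. int (Poly_Mapping.lookup e i))"

lemma finite_B: "finite B"
  using B_subset finite_subset by blast

lemma weight_add: "weight (a + b) = weight a + weight b"
  by (simp add: weight_def lookup_add sum.distrib algebra_simps)

lemma weight_generator:
  assumes "F \<subseteq> {1..n}"
  shows "weight (generator_exponent F) = int p - int (card (F \<inter> B))"
proof -
  note lookup = lookup_generator_exponent[OF assms]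
  have "0 \<notin> B" using B_subset by auto
  have "(\<Sum>i\<in>B. int (Poly_Mapping.lookup (generator_exponent F) i)) =
      (\<Sum>i\<in>B. if i \<in> F then 1 else 0)"
    using \<open>0 \<notin> B\<close> by (intro sum.cong) (auto simp: lookup)
  also have "\<dots> = int (card (F \<inter> B))"
    using finite_B by (simp add: sum.If_cases Int_commute)
  finally show ?thesis
    by (simp add: weight_def lookup)
qed

lemma weight_nonneg: "e \<in> toric_exponents \<Gamma> \<Longrightarrow> 0 \<le> weight e"
proof (induction rule: toric_exponents.induct)
  case zero
  show ?case by (simp add: weight_def)
next
  case (step F e)
  then show ?case
    using card_face_Int[of F] weight_generator[OF face_subset, of F] by (simp add: weight_add)
qed

lemma keys_toric_exponents: "e \<in> toric_exponents \<Gamma> \<Longrightarrow> Poly_Mapping.keys e \<subseteq> {0..n}"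
proof (induction rule: toric_exponents.induct)
  case zero
  show ?case by simp
next
  case (step F e)
  have F: "F \<subseteq> {1..n}" using step(1) by (rule face_subset)
  have "Poly_Mapping.keys (generator_exponent F) = insert 0 F"
    by (auto simp: in_keys_iff lookup_generator_exponent[OF F] split: if_splits)
  with F have "Poly_Mapping.keys (generator_exponent F) \<subseteq> {0..n}"
    by auto
  with step keys_add[of "generator_exponent F" e] show ?case by blast
qed

text \<open>The monomials with exponents \<open>u\<close> and \<open>v\<close> are associated in the localization of the toric ring
  at its monomials of weight zero.\<close>

definition weight_equiv :: "(nat \<Rightarrow>\<^sub>0 nat) \<Rightarrow> (nat \<Rightarrow>\<^sub>0 nat) \<Rightarrow> bool" where
  "weight_equiv u v \<longleftrightarrow> (\<exists>a\<in>toric_exponents \<Gamma>. \<exists>b\<in>toric_exponents \<Gamma>.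
     weight a = 0 \<and> weight b = 0 \<and> a + u = b + v)"

lemma weight_equivI:
  "a \<in> toric_exponents \<Gamma> \<Longrightarrow> b \<in> toric_exponents \<Gamma> \<Longrightarrow> weight a = 0 \<Longrightarrow> weight b = 0 \<Longrightarrow>
    a + u = b + v \<Longrightarrow> weight_equiv u v"
  unfolding weight_equiv_def by blast

lemma weight_zero: "weight 0 = 0"
  by (simp add: weight_def)

lemma weight_equiv_refl: "weight_equiv u u"
  by (rule weight_equivI[of 0 0]) (auto simp: weight_zero toric_exponents.zero)

lemma weight_equiv_sym: "weight_equiv u v \<Longrightarrow> weight_equiv v u"
  unfolding weight_equiv_def by metis

lemma weight_equiv_trans [trans]:
  assumes "weight_equiv u v" "weight_equiv v x"
  shows "weight_equiv u x"
proof -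
  obtain a b where 1: "a \<in> toric_exponents \<Gamma>" "b \<in> toric_exponents \<Gamma>" "weight a = 0"
    "weight b = 0" "a + u = b + v" using assms(1) unfolding weight_equiv_def by blast
  obtain c d where 2: "c \<in> toric_exponents \<Gamma>" "d \<in> toric_exponents \<Gamma>" "weight c = 0"
    "weight d = 0" "c + v = d + x" using assms(2) unfolding weight_equiv_def by blast
  have "(c + a) + u = b + (c + v)"
    by (simp only: add.assoc 1(5) add.left_commute)
  also have "\<dots> = (b + d) + x"
    unfolding 2(5) by (simp add: ac_simps)
  finally show ?thesis
    using 1 2 by (intro weight_equivI[of "c + a" "b + d"])
      (auto simp: weight_add intro: toric_exponents_add)
qed

lemma weight_equiv_add:
  assumes "weight_equiv u v" "weight_equiv x z"
  shows "weight_equiv (u + x) (v + z)"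
proof -
  obtain a b where 1: "a \<in> toric_exponents \<Gamma>" "b \<in> toric_exponents \<Gamma>" "weight a = 0"
    "weight b = 0" "a + u = b + v" using assms(1) unfolding weight_equiv_def by blast
  obtain c d where 2: "c \<in> toric_exponents \<Gamma>" "d \<in> toric_exponents \<Gamma>" "weight c = 0"
    "weight d = 0" "c + x = d + z" using assms(2) unfolding weight_equiv_def by blast
  have "(a + c) + (u + x) = (a + u) + (c + x)"
    by (simp only: ac_simps)
  also have "\<dots> = (b + d) + (v + z)"
    unfolding 1(5) 2(5) by (simp only: ac_simps)
  finally show ?thesis
    using 1 2 by (intro weight_equivI[of "a + c" "b + d"])
      (auto simp: weight_add intro: toric_exponents_add)
qed

text \<open>A face meeting \<open>B\<close> in \<open>p\<close> vertices has a monomial of weight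
  zero, so it becomes a unit. The two exchange lemmas below compare two such faces.\<close>

lemma weight_equiv_generator:
  assumes "F \<in> \<Gamma>" "G \<in> \<Gamma>" "card (F \<inter> B) = p" "card (G \<inter> B) = p"
    and "generator_exponent F + u = generator_exponent G + v"
  shows "weight_equiv u v"
  using assms face_subset
  by (intro weight_equivI[of "generator_exponent F" "generator_exponent G"])
    (auto simp: weight_generator generator_in_toric_exponents)

lemma generator_exponent_insert:
  assumes "finite F" "i \<notin> F"
  shows "generator_exponent (insert i F) = Poly_Mapping.single i 1 + generator_exponent F"
  using assms by (simp add: generator_exponent_def ac_simps)

text \<open>The monomials of \<open>A\<close> and \<open>insert i A\<close> both have weight zero
  and their quotient is \<open>x\<^sub>i\<close>, so \<open>x\<^sub>i\<close> becomes a
  unit.\<close>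

lemma weight_equiv_outside:
  assumes "i \<in> {1..n}" "i \<notin> B"
  shows "weight_equiv (Poly_Mapping.single i c) 0"
proof -
  obtain A where A: "A \<subseteq> B" "card A = p" "insert i A \<in> \<Gamma>"
    using extend_face assms by blast
  have "finite A" using A finite_B finite_subset by blast
  have "weight_equiv (Poly_Mapping.single i 1) 0"
  proof (rule weight_equiv_generator)
    show "A \<in> \<Gamma>" using A small_face by simp
    show "insert i A \<in> \<Gamma>" by fact
    show "card (A \<inter> B) = p" "card (insert i A \<inter> B) = p"
      using A assms by (simp_all add: Int_absorb2)
    show "generator_exponent A + Poly_Mapping.single i 1 = generator_exponent (insert i A) + 0"
      using A assms \<open>finite A\<close> by (subst generator_exponent_insert) (auto simp: add.commute)
  qed
  then show ?thesis
  proof (induction c)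
    case 0
    show ?case by (simp add: weight_equiv_refl)
  next
    case (Suc c)
    from weight_equiv_add[OF Suc.prems Suc.IH[OF Suc.prems]] show ?case
      using single_add[of i 1 c] by simp
  qed
qed

text \<open>Two \<open>p\<close>-subsets of \<open>B\<close> that differ by exchanging
  \<open>i\<close> and \<open>b\<close> have monomials with quotient
  \<open>x\<^sub>i / x\<^sub>b\<close>, so all variables in \<open>B\<close> agree up to
  units.\<close>

lemma weight_equiv_inside:
  assumes "i \<in> B" "b \<in> B"
  shows "weight_equiv (Poly_Mapping.single i c) (Poly_Mapping.single b c)"
proof (cases "i = b")
  case True
  then show ?thesis using weight_equiv_refl by simp
next
  case False
  then have "card {i, b} \<le> card B"
    using assms finite_B by (intro card_mono) auto
  \<comment> \<open>Two distinct vertices rule out \<open>card B = 1\<close>; the strict inequality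
    leaves room for \<open>p - 1\<close> vertices avoiding both \<open>i\<close> and
    \<open>b\<close>.\<close>
  with False p_less have "p < card B" by auto
  moreover have "card (B - {i, b}) = card B - 2"
    using False assms by (subst card_Diff_subset) auto
  ultimately have "p - 1 \<le> card (B - {i, b})" by linarith
  then obtain A where A: "A \<subseteq> B - {i, b}" "card A = p - 1"
    by (meson obtain_subset_with_card_n)
  have "finite A" using A finite_B finite_subset by blast
  have card: "card (insert j A) = p" if "j \<in> {i, b}" for j
    using A that \<open>finite A\<close> p_pos by (subst card_insert_disjoint) auto
  have "weight_equiv (Poly_Mapping.single i 1) (Poly_Mapping.single b 1)"
  proof (rule weight_equiv_generator)
    show "insert b A \<in> \<Gamma>" "insert i A \<in> \<Gamma>"
      using A assms card by (auto intro!: small_face)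
    have "insert b A \<inter> B = insert b A" "insert i A \<inter> B = insert i A"
      using A assms by auto
    then show "card (insert b A \<inter> B) = p" "card (insert i A \<inter> B) = p"
      using card by auto
    show "generator_exponent (insert b A) + Poly_Mapping.single i 1 =
        generator_exponent (insert i A) + Poly_Mapping.single b 1"
      using A \<open>finite A\<close> by (subst (1 2) generator_exponent_insert) (auto simp: ac_simps)
  qed
  then show ?thesis
  proof (induction c)
    case 0
    show ?case by (simp add: weight_equiv_refl)
  next
    case (Suc c)
    from weight_equiv_add[OF Suc.prems Suc.IH[OF Suc.prems]] show ?case
      using single_add[of i 1 c] single_add[of b 1 c] by simp
  qed
qed

text \<open>Variables outside \<open>B\<close> are dropped and those inside \<open>B\<close> are
  replaced by \<open>x\<^sub>b\<close>, which leaves a monomial in \<open>x\<^sub>b\<close> and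
  \<open>t\<close> alone.\<close>

lemma weight_equiv_normal_form:
  assumes "Poly_Mapping.keys e \<subseteq> {0..n}" "b \<in> B"
  shows "weight_equiv e (Poly_Mapping.single b (\<Sum>i\<in>B. Poly_Mapping.lookup e i) +
    Poly_Mapping.single 0 (Poly_Mapping.lookup e 0))"
  using assms(1)
proof (induction rule: poly_mapping_span_induct)
  case zero
  show ?case using weight_equiv_refl by simp
next
  case (single a c)
  have sum: "(\<Sum>i\<in>B. Poly_Mapping.lookup (Poly_Mapping.single a c) i) = (if a \<in> B then c else 0)"
    using finite_B by (simp add: lookup_single when_def)
  have "0 \<notin> B" using B_subset by auto
  consider "a = 0" | "a \<in> B" "a \<noteq> 0" | "a \<notin> B" "a \<in> {1..n}" "a \<noteq> 0"
    using single by fastforce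
  then show ?case
  proof cases
    case 1
    with \<open>0 \<notin> B\<close> show ?thesis unfolding sum by (simp add: weight_equiv_refl)
  next
    case 2
    with assms(2) show ?thesis
      unfolding sum by (simp add: weight_equiv_inside lookup_single)
  next
    case 3
    then show ?thesis
      unfolding sum by (simp add: weight_equiv_outside lookup_single)
  qed
next
  case (add f g)
  from weight_equiv_add[OF this] show ?case
    by (simp add: lookup_add sum.distrib single_add ac_simps)
qed

text \<open>For a \<open>p\<close>-subset \<open>A\<close> of \<open>B\<close> the monomial
  \<open>x\<^sub>A t\<close> has weight zero and normal form \<open>x\<^sub>b\<^sup>p t\<close>, so
  the latter and its powers are units.\<close>

lemma weight_equiv_facet:
  assumes "b \<in> B"
  shows "weight_equiv (Poly_Mapping.single b (p * j) + Poly_Mapping.single 0 j) 0"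
proof (induction j)
  case 0
  show ?case using weight_equiv_refl by simp
next
  case (Suc j)
  obtain A where A: "A \<subseteq> B" "card A = p"
    using p_le by (meson obtain_subset_with_card_n)
  then have face: "A \<in> \<Gamma>" using small_face by simp
  let ?e = "generator_exponent A"
  note lookup = lookup_generator_exponent[OF face_subset[OF face]]
  have "weight ?e = 0"
    using A face_subset[OF face] by (simp add: weight_generator Int_absorb2)
  then have "(\<Sum>i\<in>B. Poly_Mapping.lookup ?e i) = p"
    by (simp add: weight_def lookup flip: of_nat_sum)
  then have "weight_equiv ?e (Poly_Mapping.single b p + Poly_Mapping.single 0 1)"
    using weight_equiv_normal_form[OF keys_toric_exponents[OF generator_in_toric_exponents[OF face]] assms]
    by (simp add: lookup)
  then have "weight_equiv (Poly_Mapping.single b p + Poly_Mapping.single 0 1) ?e"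
    by (rule weight_equiv_sym)
  also have "weight_equiv ?e 0"
    by (rule weight_equivI[of 0 ?e])
      (use \<open>weight ?e = 0\<close> in \<open>auto simp: weight_zero toric_exponents.zero
        generator_in_toric_exponents[OF face]\<close>)
  finally have "weight_equiv (Poly_Mapping.single b p + Poly_Mapping.single 0 1) 0" .
  from weight_equiv_add[OF this Suc] show ?case
    using single_add[of b p "p * j"] single_add[of "0 :: nat" 1 j] by (simp add: ac_simps)
qed

text \<open>Normal forms of equal weight differ by a power of the unit
  \<open>x\<^sub>b\<^sup>p t\<close>. By symmetry \<open>v\<close> may be taken to have the larger
  exponent of \<open>t\<close>, and \<open>j\<close> is the difference.\<close>

lemma weight_equivI_weight:
  assumes "Poly_Mapping.keys u \<subseteq> {0..n}" "Poly_Mapping.keys v \<subseteq> {0..n}" "weight u = weight v"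
  shows "weight_equiv u v"
  using assms
proof (induction "Poly_Mapping.lookup u 0" "Poly_Mapping.lookup v 0" arbitrary: u v rule: linorder_wlog)
  case (le u v)
  let ?s = "\<lambda>e. \<Sum>i\<in>B. Poly_Mapping.lookup e i" and ?k = "\<lambda>e. Poly_Mapping.lookup e 0"
  obtain b where b: "b \<in> B" using p_pos p_le by fastforce
  define j where "j = ?k v - ?k u"
  have k: "?k v = ?k u + j" using le(1) by (simp add: j_def)
  have "int p * int (?k u) - int (?s u) = int p * int (?k v) - int (?s v)"
    using le(4) by (simp add: weight_def)
  then have "int (?s v) = int (?s u + p * j)" by (simp add: k algebra_simps)
  then have s: "?s v = ?s u + p * j" by (simp only: of_nat_eq_iff)
  have "weight_equiv u (Poly_Mapping.single b (?s u) + Poly_Mapping.single 0 (?k u) + 0)"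
    using weight_equiv_normal_form[OF le(2) b] by simp
  also have "weight_equiv \<dots> (Poly_Mapping.single b (?s u) + Poly_Mapping.single 0 (?k u) +
      (Poly_Mapping.single b (p * j) + Poly_Mapping.single 0 j))"
    by (intro weight_equiv_add weight_equiv_refl weight_equiv_sym[OF weight_equiv_facet[OF b]])
  also have "\<dots> = Poly_Mapping.single b (?s v) + Poly_Mapping.single 0 (?k v)"
    by (simp add: s k single_add ac_simps)
  also have "weight_equiv \<dots> v"
    using weight_equiv_sym[OF weight_equiv_normal_form[OF le(3) b]] .
  finally show ?case .
next
  case (sym u v)
  then show ?case using weight_equiv_sym by metis
qed

text \<open>A face of \<open>p - 1\<close> vertices of \<open>B\<close> gives a monomial
  \<open>y\<close> of weight one. A monomial \<open>u\<close> of positive weight is associated to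
  \<open>y\<close> times any monomial of weight one less than that of \<open>u\<close>.\<close>

lemma weighted_monoid_toric_exponents:
  obtains y where "weighted_monoid (toric_exponents \<Gamma>) weight y"
proof -
  obtain A where A: "A \<subseteq> B" "card A = p - 1"
    using p_le by (meson obtain_subset_with_card_n diff_le_self le_trans)
  then have face: "A \<in> \<Gamma>" using small_face by simp
  let ?y = "generator_exponent A"
  have y: "?y \<in> toric_exponents \<Gamma>" using face by (rule generator_in_toric_exponents)
  have weight_y: "weight ?y = 1"
    using A p_pos face_subset[OF face] by (simp add: weight_generator Int_absorb2)
  \<comment> \<open>Powers of \<open>y\<close> realize every nonnegative weight.\<close>
  have multiple: "\<exists>e\<in>toric_exponents \<Gamma>. weight e = int k" for k
  proof (induction k)
    case 0
    show ?case using toric_exponents.zero weight_zero by force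
  next
    case (Suc k)
    then obtain e where "e \<in> toric_exponents \<Gamma>" "weight e = int k" by blast
    with y weight_y show ?case
      by (intro bexI[of _ "?y + e"]) (auto simp: weight_add toric_exponents_add)
  qed
  have "weighted_monoid (toric_exponents \<Gamma>) weight ?y"
  proof
    fix u assume u: "u \<in> toric_exponents \<Gamma>" "0 < weight u"
    with multiple[of "nat (weight u - 1)"]
    obtain e where e: "e \<in> toric_exponents \<Gamma>" "weight e = weight u - 1" by auto
    then have "weight_equiv u (?y + e)"
      using u y weight_y
      by (intro weight_equivI_weight keys_toric_exponents toric_exponents_add)
        (auto simp: weight_add)
    then obtain a b where ab: "a \<in> toric_exponents \<Gamma>" "b \<in> toric_exponents \<Gamma>" "weight a = 0"
      "a + u = b + (?y + e)"
      unfolding weight_equiv_def by blast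
    then show "\<exists>m\<in>toric_exponents \<Gamma>. \<exists>u'\<in>toric_exponents \<Gamma>. weight m = 0 \<and> m + u = ?y + u'"
      using e by (intro bexI[of _ a] bexI[of _ "b + e"]) (auto simp: ac_simps toric_exponents_add)
  qed (use toric_exponents.zero toric_exponents_add weight_add weight_nonneg y weight_y in auto)
  with that show thesis .
qed

text \<open>The listed generators are exactly those of positive weight, and the ideal they generate
  is shown to be \<open>positive_part\<close>, to which the general results on weights
  apply.\<close>

lemma Idl_in_height_one_monomial_primes_t:
  "Idl\<^bsub>toric_ring \<Gamma>\<^esub> {xmon F * tvar | F. F \<in> \<Gamma> \<and> card (F \<inter> B) < p}
    \<in> (height_one_monomial_primes_t n \<Gamma> :: ('k::field mpoly) set set)"
proof -
  let ?R = "toric_ring \<Gamma> :: ('k mpoly) ring"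
  let ?S = "{xmon F * tvar | F. F \<in> \<Gamma> \<and> card (F \<inter> B) < p} :: 'k mpoly set"
  obtain y where "weighted_monoid (toric_exponents \<Gamma>) weight y"
    by (rule weighted_monoid_toric_exponents)
  then interpret W: weighted_monoid "toric_exponents \<Gamma>" weight y .
  have R: "?R = monoid_algebra (toric_exponents \<Gamma>)"
    by (rule toric_ring_eq_monoid_algebra)
  interpret R: domain ?R unfolding R by (rule W.domain_monoid_algebra)
  have S: "?S \<subseteq> W.positive_part"
    using face_subset
    by (auto simp: W.positive_part_def xmon_times_tvar generator_in_toric_exponents weight_generator)
  also have carrier: "W.positive_part \<subseteq> carrier ?R"
    by (auto simp: R W.positive_part_def)
  finally have SR: "?S \<subseteq> carrier ?R" .
  interpret I: ideal "Idl\<^bsub>?R\<^esub> ?S" ?R by (rule R.genideal_ideal[OF SR])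
  have mult: "f * g \<in> Idl\<^bsub>?R\<^esub> ?S" "g * f \<in> Idl\<^bsub>?R\<^esub> ?S"
    if "f \<in> Idl\<^bsub>?R\<^esub> ?S" "Poly_Mapping.keys g \<subseteq> toric_exponents \<Gamma>" for f g
    using I.I_l_closed[of f g] I.I_r_closed[of f g] that by (auto simp: R)
  \<comment> \<open>A product of generators has positive weight only if some factor does. When a
    generator is peeled off, either the rest still has positive weight or the generator itself lies
    in \<open>?S\<close>.\<close>
  have single_mem: "Poly_Mapping.single e c \<in> Idl\<^bsub>?R\<^esub> ?S"
    if "e \<in> toric_exponents \<Gamma>" "0 < weight e" for e c
    using that
  proof (induction rule: toric_exponents.induct)
    case zero
    then show ?case by (simp add: weight_zero)
  next
    case (step F e)
    have eq: "Poly_Mapping.single (generator_exponent F + e) c =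
        Poly_Mapping.single (generator_exponent F) 1 * Poly_Mapping.single e c"
      by (simp add: mult_single)
    show ?case
    proof (cases "0 < weight e")
      case True
      with step show ?thesis
        unfolding eq by (intro mult(2)) (auto simp: generator_in_toric_exponents)
    next
      case False
      with step have "0 < weight (generator_exponent F)"
        by (simp add: weight_add)
      with step(1) face_subset[OF step(1)] have "xmon F * tvar \<in> ?S"
        by (auto simp: weight_generator)
      with SR R.genideal_self have "xmon F * tvar \<in> Idl\<^bsub>?R\<^esub> ?S" by blast
      with step(2) show ?thesis
        unfolding eq by (intro mult(1)) (auto simp: xmon_times_tvar)
    qed
  qed
  have "f \<in> Idl\<^bsub>?R\<^esub> ?S" if "f \<in> W.positive_part" for f
  proof -
    from that have "Poly_Mapping.keys f \<subseteq> {e \<in> toric_exponents \<Gamma>. 0 < weight e}"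
      by (simp add: W.positive_part_def)
    then show ?thesis
    proof (induction rule: poly_mapping_span_induct)
      case zero
      show ?case using additive_subgroup.zero_closed[OF I.is_additive_subgroup] by (simp add: R)
    next
      case (single a c)
      then show ?case using single_mem by blast
    next
      case (add f g)
      then show ?case using additive_subgroup.a_closed[OF I.is_additive_subgroup] by (simp add: R)
    qed
  qed
  moreover have "Idl\<^bsub>?R\<^esub> ?S \<subseteq> W.positive_part"
    using S by (intro R.genideal_minimal) (simp_all add: R W.ideal_positive_part)
  ultimately have Idl: "Idl\<^bsub>?R\<^esub> ?S = W.positive_part" by blast
  have "?S \<subseteq> monomials n \<inter> carrier ?R"
    using SR face_subset xmon_times_tvar_in_monomials by blast
  then have "monomial_ideal n \<Gamma> (Idl\<^bsub>?R\<^esub> ?S)"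
    unfolding monomial_ideal_def by blast
  \<comment> \<open>The element \<open>t\<close> is the generator of the empty face, which meets
    \<open>B\<close> in fewer than \<open>p\<close> vertices.\<close>
  moreover have "xmon {} * tvar \<in> ?S"
    using small_face[of "{}"] p_pos by (intro CollectI exI[of _ "{}"]) auto
  then have "xmon {} * tvar \<in> Idl\<^bsub>?R\<^esub> ?S"
    using R.genideal_self[OF SR] by blast
  then have "tvar \<in> Idl\<^bsub>?R\<^esub> ?S"
    by (simp add: xmon_def)
  ultimately show ?thesis
    unfolding height_one_monomial_primes_t_def
    by (simp add: Idl) (simp add: R W.primeideal_positive_part W.height_positive_part)
qed

end

section \<open>Independence complexes and maximal cliques\<close>

lemma pure_complex_facets:
  assumes "simplicial_complex n \<Delta>" "pure_complex \<Delta>" "complex_dim \<Delta> = int d - 1" "F \<in> facets \<Delta>"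
  shows "card F = d" "F \<subseteq> {1..n}"
  using assms unfolding pure_complex_def simplicial_complex_def facets_def by auto

text \<open>If no \<open>A\<close> of size \<open>d - 1\<close> inside a maximal clique \<open>B\<close> had \<open>A \<union> {i}\<close> independent, then
  \<open>B \<union> {i}\<close> would be a clique.\<close>

lemma maximal_clique_extend:
  assumes complex: "simplicial_complex n \<Delta>" "pure_complex \<Delta>" "complex_dim \<Delta> = int d - 1"
    and B: "B \<in> maximal_cliques n \<Delta>" and i: "i \<in> {1..n}" "i \<notin> B"
  shows "\<exists>A\<subseteq>B. card A = d - 1 \<and> insert i A \<in> independence_complex n \<Delta>"
proof (rule ccontr)
  assume contra: "\<not> ?thesis"
  have clique: "clique n \<Delta> B" and max: "\<And>D. clique n \<Delta> D \<Longrightarrow> B \<subseteq> D \<Longrightarrow> D = B"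
    using B by (auto simp: maximal_cliques_def)
  have "clique n \<Delta> (insert i B)"
    unfolding clique_def
  proof (intro conjI allI impI)
    show "insert i B \<subseteq> {1..n}" using clique i by (simp add: clique_def)
  next
    fix F assume F: "F \<subseteq> insert i B \<and> int (card F) - 1 = complex_dim \<Delta>"
    then have card: "card F = d" using complex by simp
    have fin: "finite F"
      using F clique by (auto simp: clique_def intro: finite_subset[of F "insert i B"] finite_subset)
    show "F \<in> facets \<Delta>"
    proof (cases "i \<in> F")
      case True
      \<comment> \<open>Here \<open>F - {i}\<close> is a candidate for \<open>A\<close>, so by
        assumption \<open>F\<close> contains a facet; both have \<open>d\<close> elements and
        therefore coincide.\<close>
      then have "F - {i} \<subseteq> B" "card (F - {i}) = d - 1" "insert i (F - {i}) = F"
        using F card fin by auto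
      with contra have "F \<notin> independence_complex n \<Delta>" by metis
      moreover have "F \<subseteq> {1..n}" using F clique i by (auto simp: clique_def)
      ultimately obtain G where "G \<in> facets \<Delta>" "G \<subseteq> F"
        by (auto simp: independence_complex_def)
      with pure_complex_facets[OF complex] card fin show ?thesis
        by (metis card_subset_eq)
    next
      case False
      with F clique show ?thesis by (auto simp: clique_def)
    qed
  qed
  with max i show False by blast
qed

theorem corollary3p2:
  fixes n d m :: nat and \<Delta> \<Gamma> :: "nat set set" and B :: "nat \<Rightarrow> nat set"
  assumes "unit_interval_complex n \<Delta>"
    and "complex_dim \<Delta> = int d - 1" and "int d - 1 > 1"
    and "\<Gamma> = independence_complex n \<Delta>"
    and "bij_betw B {1..m} (maximal_cliques n \<Delta>)"
  shows "{P_ideal \<Gamma> i | i. i \<in> {1..n}} \<union> {L_ideal \<Gamma> d (B j) | j. j \<in> {1..m}}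
    \<subseteq> (height_one_monomial_primes_t n \<Gamma> :: ('k::field mpoly) set set)"
proof -
  have complex: "simplicial_complex n \<Delta>" "pure_complex \<Delta>" "complex_dim \<Delta> = int d - 1"
    using assms(1,2) by (auto simp: unit_interval_complex_def)
  have face_subset: "F \<subseteq> {1..n}" if "F \<in> \<Gamma>" for F
    using that by (simp add: assms(4) independence_complex_def)
  \<comment> \<open>Every facet has \<open>d\<close> elements and cannot fit into a smaller
    set.\<close>
  have small_face: "F \<in> \<Gamma>" if "F \<subseteq> {1..n}" "card F < d" for F
  proof -
    have "\<not> G \<subseteq> F" if "G \<in> facets \<Delta>" for G
      using pure_complex_facets[OF complex that] \<open>card F < d\<close> card_mono[of F G]
        finite_subset[OF \<open>F \<subseteq> {1..n}\<close>] by auto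
    with that show ?thesis by (auto simp: assms(4) independence_complex_def)
  qed
  have "P_ideal \<Gamma> i \<in> (height_one_monomial_primes_t n \<Gamma> :: ('k mpoly) set set)"
    if i: "i \<in> {1..n}" for i
  proof -
    have "facet_weight n 1 \<Gamma> {i}"
    proof
      show "card (F \<inter> {i}) \<le> 1" for F
        using card_mono[of "{i}" "F \<inter> {i}"] by simp
      show "A \<in> \<Gamma>" if "A \<subseteq> {i}" "card A \<le> 1" for A
        using that i assms(3) by (intro small_face) auto
      \<comment> \<open>The edge on \<open>i\<close> and \<open>j\<close> is independent because
        \<open>d\<close> is at least 3.\<close>
      show "\<exists>A\<subseteq>{i}. card A = 1 \<and> insert j A \<in> \<Gamma>" if "j \<in> {1..n}" "j \<notin> {i}" for j
        using that i assms(3) by (intro exI[of _ "{i}"]) (auto intro!: small_face)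
    qed (use i face_subset in auto)
    moreover have "card (F \<inter> {i}) < 1 \<longleftrightarrow> i \<notin> F" for F
      by (cases "i \<in> F") auto
    ultimately show ?thesis
      using facet_weight.Idl_in_height_one_monomial_primes_t[of n 1 \<Gamma> "{i}"]
      by (simp add: P_ideal_def del: One_nat_def)
  qed
  moreover have "L_ideal \<Gamma> d (B j) \<in> (height_one_monomial_primes_t n \<Gamma> :: ('k mpoly) set set)"
    if "j \<in> {1..m}" for j
  proof -
    let ?B = "B j"
    have B: "?B \<in> maximal_cliques n \<Delta>"
      using assms(5) that by (auto simp: bij_betw_def)
    then have clique: "clique n \<Delta> ?B" and card: "d \<le> card ?B"
      using complex by (auto simp: maximal_cliques_def)
    then have subset: "?B \<subseteq> {1..n}" by (simp add: clique_def)
    have "facet_weight n (d - 1) \<Gamma> ?B"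
    proof
      \<comment> \<open>Any \<open>d\<close> vertices of a clique form a facet, which an independent
        set cannot contain.\<close>
      show "card (F \<inter> ?B) \<le> d - 1" if F: "F \<in> \<Gamma>" for F
      proof (rule ccontr)
        assume "\<not> ?thesis"
        then have "d \<le> card (F \<inter> ?B)" by simp
        then obtain G where "G \<subseteq> F \<inter> ?B" "card G = d"
          by (meson obtain_subset_with_card_n)
        moreover from this clique complex have "G \<in> facets \<Delta>"
          by (auto simp: clique_def)
        ultimately show False
          using F by (auto simp: assms(4) independence_complex_def)
      qed
      show "A \<in> \<Gamma>" if "A \<subseteq> ?B" "card A \<le> d - 1" for A
        using that subset assms(3) by (intro small_face) auto
      show "\<exists>A\<subseteq>?B. card A = d - 1 \<and> insert i A \<in> \<Gamma>" if "i \<in> {1..n}" "i \<notin> ?B" for i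
        using maximal_clique_extend[OF complex B that] by (simp add: assms(4))
    qed (use card subset assms(3) face_subset in auto)
    \<comment> \<open>\<open>L_ideal\<close> subtracts in the integers and
      \<open>facet_weight\<close> in the naturals; the two agree since \<open>d\<close> is
      positive.\<close>
    moreover have "int c < int d - 1 \<longleftrightarrow> c < d - 1" for c
      using assms(3) by linarith
    ultimately show ?thesis
      using facet_weight.Idl_in_height_one_monomial_primes_t[of n "d - 1" \<Gamma> ?B]
      by (simp add: L_ideal_def)
  qed
  ultimately show ?thesis by blast
qed

end
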